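(* Let $\lambda,\mu>0$, $0<a<1$, $s,t>0$, and put $y=\frac{\lambda t}{a}>0$, $z=\frac{\lambda t-a\mu s}{a}<y$. The terms $Q_{m,n},A_{m,n},B_{m,n},C_{m,n}$ defined in the context can be expressed in terms of finite combinations of elementary functions, as follows. (i) When $z<0$ (namely $a\mu s>\lambda t$), for $m\ge n\ge0$, $$Q_{m,n}(y,z)=\sum_{k=n}^m\sum_{j=k}^m\frac{(-1)^{j-k}}{a^j}\binom jk\sum_{\ell=0}^n\beta_\ell(n)\,\pi_{m-j}(y-z)\,\pi_{j+\ell}(ay)\,\Phi(j+1;j+\ell+1;ay).$$ (ii) When $z>0$ (namely $a\mu s<\lambda t$), for every $n,m\ge0$, $$A_{m,n}(y,z)=\pi_m(y-z)\sum_{k=0}^n\beta_k(n)\Big[1+\pi_k(az)-\sum_{j=0}^k\pi_j(az)\Big];$$ for $n\ge m\ge0$, $$B_{m,n}(y,z)=\pi_m(y-z)\sum_{k=0}^{n-m}\pi_k(z)\sum_{\ell=0}^{n+1}\beta_\ell(n+1)\frac{(az)^\ell k!}{(k+\ell)!}\,\Phi\big(\ell;k+\ell+1;(1-a)z\big);$$ and for $m\ge n\ge1$ (while for $m\ge n=0$ always $C_{m,0}(y,z)=0$), $$C_{m,n}(y,z)=\frac{e^{-(1-a)(y-z)}}{a^m}\sum_{\ell=1}^n\beta_\ell(n)\sum_{k=n}^m\sum_{j=0}^{\ell-1}(-1)^{\ell-1-j}\binom{k+\ell-j-1}{k}\,\pi_j(ay)\,\pi_{m+\ell-j}(a(y-z))\,\Phi\big(k+\ell-j;m+\ell-j+1;a(y-z)\big).$$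 (iii) The parameters $\alpha,\beta$ of the confluent hypergeometric functions $\Phi(\alpha;\beta;x)$ involved in the previous formulas are integers with $0\le\alpha<\beta$, and hence these functions are just finite combinations of powers and exponentials according to the following formulas: $$\Phi(0;\beta;x)=1\qquad(\beta>\alpha=0),$$ $$\Phi(\alpha;\beta;x)=e^x\sum_{\gamma=1}^\alpha(-1)^{\alpha-\gamma}\binom{\beta-\gamma-1}{\beta-\alpha-1}\frac{\pi_{\gamma-1}(x)}{\pi_{\beta-1}(x)}\,\Pi_{\alpha-\gamma+1}(x)\qquad(\beta>\alpha\ge1).$$
   Context: Notation: $\Phi(\alpha;\beta;x)=\sum_{r\ge0}\frac{(\alpha)_r}{(\beta)_r}\frac{x^r}{r!}$ is the confluent hypergeometric function, $(\cdot)_r$ being the Pochhammer symbol. For $n=0,1,2,\ldots$, $\pi_n(x)=\frac{x^n}{n!}e^{-x}$ (with $\pi_n(0)=\delta_{n,0}$) and $\Pi_n(x)=\sum_{k=n}^\infty\pi_k(x)$. $\beta_k(n)=\binom nk a^{n-k}(1-a)^k$ for $k=0,\ldots,n$ (so $\beta_0(0)=1$). $f_0(x)=\delta(x)$ (Dirac delta), and for $k\ge1$ $f_k(x)=\frac{x^{k-1}}{(k-1)!}e^{-x}$ for $x\ge0$, $f_k(x)=0$ for $x<0$; $h_n(x)=\sum_{k=0}^n\beta_k(n)f_k(x)$. Definitions of the terms: for $z<0$, $$Q_{m,n}(y,z)=a\int_0^y dw\,h_n(aw)\sum_{k=n}^m\pi_{m-k}(w-z)\,\pi_k(y-w),\qquad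 m\ge n\ge0;$$ for $0<z<y$, $$A_{m,n}(y,z)=a\int_0^z dw\,h_n(aw)\,\pi_m(y-z),\qquad n,m\ge0,$$ $$B_{m,n}(y,z)=a\int_0^z dw\,h_{n+1}(aw)\sum_{k=0}^{n-m}\pi_k(z-w)\,\pi_m(y-z),\qquad n\ge m\ge0,$$ $$C_{m,n}(y,z)=a\int_z^y dw\,h_n(aw)\sum_{k=n}^m\pi_{m-k}(w-z)\,\pi_k(y-w),\qquad m\ge n\ge1,$$ and $C_{m,0}(y,z)=0$ for $m\ge0$. Convention for the Dirac delta: $\int_0^b\delta(x)\,dx=1$ for every $b>0$, while integrals over $[z,b]$ with $z>0$ receive no contribution from it. Explicitly, for continuous $\xi$ and $b>0$, $a\int_0^b h_n(aw)\xi(w)\,dw=a^n\xi(0)+a\int_0^b\sum_{k=1}^n\beta_k(n)f_k(aw)\xi(w)\,dw$, and for $0<z<b$, $a\int_z^b h_n(aw)\xi(w)\,dw=a\int_z^b\sum_{k=1}^n\beta_k(n)f_k(aw)\xi(w)\,dw$.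
   Formalization: In (iii) the factor Π_{α−γ+1}(x) is corrected to Π_{β−γ}(x), for x≠0 (as printed it fails at α=1, β=3); α<β is claimed in Q only for ℓ≥1, since for ℓ=0 one has α=β=j+1, where Φ(α;α;x)=e^x is stated instead. *)

theory Defs
  imports "HOL-Analysis.Analysis"
begin

definition Phi :: "real \<Rightarrow> real \<Rightarrow> real \<Rightarrow> real" where
  "Phi \<alpha> \<beta> x = (\<Sum>r. pochhammer \<alpha> r / pochhammer \<beta> r * (x ^ r / fact r))"

definition poi :: "nat \<Rightarrow> real \<Rightarrow> real" where
  "poi n x = x ^ n / fact n * exp (- x)"

definition Poi :: "nat \<Rightarrow> real \<Rightarrow> real" where
  "Poi n x = (\<Sum>k. poi (n + k) x)"

definition bet :: "real \<Rightarrow> nat \<Rightarrow> nat \<Rightarrow> real" where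
  "bet a k n = real (n choose k) * a ^ (n - k) * (1 - a) ^ k"

(* The density f_k, only meant for k \<ge> 1; f_0 is the Dirac delta, accounted for in h_int. *)
definition gam :: "nat \<Rightarrow> real \<Rightarrow> real" where
  "gam k x = (if x < 0 then 0 else x ^ (k - 1) / fact (k - 1) * exp (- x))"

(* The integral of a * h_n(a w) * xi(w) dw over [l,u], where h_n is the sum over k = 0..n of
   bet a k n times f_k.  As a * delta(a w) = delta(w), the term k = 0 contributes
   bet a 0 n * xi 0 (that is, a^n * xi 0) if the interval contains 0, even as its left endpoint,
   and nothing otherwise. *)
definition h_int :: "real \<Rightarrow> nat \<Rightarrow> real \<Rightarrow> real \<Rightarrow> (real \<Rightarrow> real) \<Rightarrow> real" where
  "h_int a n l u \<xi> =
     (if 0 \<in> {l..u} then bet a 0 n * \<xi> 0 else 0)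
     + a * integral {l..u} (\<lambda>w. (\<Sum>k=1..n. bet a k n * gam k (a * w)) * \<xi> w)"

(* Q is meant for z < 0 < y and n \<le> m; A, B, C for 0 < z < y, with m \<le> n in B
   and n \<le> m in C. *)
definition Q_term :: "real \<Rightarrow> nat \<Rightarrow> nat \<Rightarrow> real \<Rightarrow> real \<Rightarrow> real" where
  "Q_term a m n y z = h_int a n 0 y (\<lambda>w. \<Sum>k=n..m. poi (m - k) (w - z) * poi k (y - w))"

definition A_term :: "real \<Rightarrow> nat \<Rightarrow> nat \<Rightarrow> real \<Rightarrow> real \<Rightarrow> real" where
  "A_term a m n y z = h_int a n 0 z (\<lambda>w. poi m (y - z))"

definition B_term :: "real \<Rightarrow> nat \<Rightarrow> nat \<Rightarrow> real \<Rightarrow> real \<Rightarrow> real" where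
  "B_term a m n y z =
     h_int a (n + 1) 0 z (\<lambda>w. (\<Sum>k=0..n - m. poi k (z - w)) * poi m (y - z))"

definition C_term :: "real \<Rightarrow> nat \<Rightarrow> nat \<Rightarrow> real \<Rightarrow> real \<Rightarrow> real" where
  "C_term a m n y z =
     (if n = 0 then 0
      else h_int a n z y (\<lambda>w. \<Sum>k=n..m. poi (m - k) (w - z) * poi k (y - w)))"

definition admissible :: "real \<Rightarrow> real \<Rightarrow> bool" where
  "admissible \<alpha> \<beta> \<longleftrightarrow> \<alpha> \<in> \<int> \<and> \<beta> \<in> \<int> \<and> 0 \<le> \<alpha> \<and> \<alpha> < \<beta>"

end

theory Submission
  imports Defs
begin

text \<open>
  Everything reduces to Euler's integral
  \<open>\<integral> (w - l)\<^sup>p (u - w)\<^sup>q exp (c (u - w)) dw = p! q! / (p + q + 1)! (u - l)\<^sup>p\<^sup>+\<^sup>q\<^sup>+\<^sup>1 \<Phi> (q + 1; p + q + 2; c (u - l))\<close>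
  over \<open>[l, u]\<close>, which follows by integrating the exponential series term by term, and its mirror image.
  In \<open>Q\<close> the factor \<open>w - z = (y - z) - (y - w)\<close> is expanded by the binomial theorem, in \<open>C\<close> the
  factor \<open>w = y - (y - w)\<close>; \<open>B\<close> is such an integral as it stands, and \<open>A\<close> only needs the tail of the
  Poisson distribution as an antiderivative. The closed form of \<open>\<Phi>\<close> comes from expanding
  \<open>(1 - w)\<^sup>q\<close> in the same integral over \<open>[0, 1]\<close>.
\<close>

section \<open>Euler's integral for \<open>Phi\<close>\<close>

lemma pochhammer_of_nat_Suc:
  "pochhammer (of_nat n + 1 :: 'a::field_char_0) r = fact (n + r) / fact n"
  by (induction r) (simp_all add: pochhammer_Suc add_ac)

text \<open>Integration by parts trades a factor \<open>u - w\<close> for a factor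
  \<open>w - l\<close>; the exponent \<open>p\<close> grows on the way, so the induction on
  \<open>q\<close> keeps it arbitrary.\<close>

lemma has_integral_beta:
  fixes l u :: real
  assumes "l \<le> u"
  shows "((\<lambda>w. (w - l) ^ p * (u - w) ^ q) has_integral
           fact p * fact q / fact (p + q + 1) * (u - l) ^ (p + q + 1)) {l..u}"
proof (induction q arbitrary: p)
  case 0
  have "((\<lambda>w. (w - l) ^ Suc p / (real p + 1)) has_real_derivative (w - l) ^ p) (at w within {l..u})" for w
    by (rule derivative_eq_intros refl)+ (simp_all add: add.commute)
  then have "((\<lambda>w. (w - l) ^ p) has_integral
          (u - l) ^ Suc p / (real p + 1) - (l - l) ^ Suc p / (real p + 1)) {l..u}"
    using assms
    by (intro fundamental_theorem_of_calculus)
       (auto simp: has_real_derivative_iff_has_vector_derivative [symmetric] simp del: power_Suc)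
  also have "(u - l) ^ Suc p / (real p + 1) - (l - l) ^ Suc p / (real p + 1) =
               fact p * fact 0 / fact (p + 0 + 1) * (u - l) ^ (p + 0 + 1)"
    by (simp add: add.commute)
  finally show ?case
    by simp
next
  case (Suc q)
  \<comment> \<open>\<open>?F\<close> vanishes at both endpoints, so its derivative integrates to 0;
    adding the induction hypothesis at \<open>Suc p\<close> isolates the wanted integral.\<close>
  let ?F = "\<lambda>w. (w - l) ^ Suc p * (u - w) ^ Suc q"
  have "(?F has_real_derivative
          (real p + 1) * ((w - l) ^ p * (u - w) ^ Suc q) - (real q + 1) * ((w - l) ^ Suc p * (u - w) ^ q))
          (at w within {l..u})" for w
    by (rule derivative_eq_intros refl)+ (simp_all add: algebra_simps)
  then have "((\<lambda>w. (real p + 1) * ((w - l) ^ p * (u - w) ^ Suc q) -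
          (real q + 1) * ((w - l) ^ Suc p * (u - w) ^ q)) has_integral ?F u - ?F l) {l..u}"
    using assms
    by (intro fundamental_theorem_of_calculus)
       (auto simp: has_real_derivative_iff_has_vector_derivative [symmetric] simp del: power_Suc)
  from has_integral_add [OF this has_integral_mult_right [OF Suc.IH [of "Suc p"], of "real q + 1"]]
  have "((\<lambda>w. (real p + 1) * ((w - l) ^ p * (u - w) ^ Suc q)) has_integral
          (real q + 1) * (fact (Suc p) * fact q / fact (Suc p + q + 1) * (u - l) ^ (Suc p + q + 1))) {l..u}"
    by simp
  from has_integral_mult_right [OF this, of "1 / (real p + 1)"]
  have "((\<lambda>w. (w - l) ^ p * (u - w) ^ Suc q) has_integral 1 / (real p + 1) *
          ((real q + 1) * (fact (Suc p) * fact q / fact (Suc p + q + 1) * (u - l) ^ (Suc p + q + 1)))) {l..u}"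
    by (simp add: add_eq_0_iff del: power_Suc)
  also have "1 / (real p + 1) *
          ((real q + 1) * (fact (Suc p) * fact q / fact (Suc p + q + 1) * (u - l) ^ (Suc p + q + 1))) =
        fact p * fact (Suc q) / fact (p + Suc q + 1) * (u - l) ^ (p + Suc q + 1)"
    using fact_Suc [of p, where 'a = real] fact_Suc [of q, where 'a = real]
    by (simp add: add_ac del: fact_Suc)
  finally show ?case .
qed

text \<open>The \<open>r\<close>-th term of the exponential series only raises the exponent
  \<open>q\<close> to \<open>q + r\<close>. The quotient of the Beta values for \<open>q + r\<close>
  and \<open>q\<close> is the Pochhammer quotient in \<open>Phi\<close>, because each Pochhammer
  symbol is a quotient of factorials.\<close>

lemma has_integral_beta_exp_right:
  fixes l u c :: real
  assumes "l \<le> u"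
  shows "((\<lambda>w. (w - l) ^ p * (u - w) ^ q * exp (c * (u - w))) has_integral
           fact p * fact q / fact (p + q + 1) * (u - l) ^ (p + q + 1) *
           Phi (real q + 1) (real p + real q + 2) (c * (u - l))) {l..u}"
proof -
  define f where "f r w = (w - l) ^ p * (u - w) ^ q * ((c * (u - w)) ^ r / fact r)" for r w
  define g where "g w = (w - l) ^ p * (u - w) ^ q * exp (c * (u - w))" for w
  define T where "T r = pochhammer (real q + 1) r / pochhammer (real p + real q + 2) r *
                        ((c * (u - l)) ^ r / fact r)" for r
  define K where "K = fact p * fact q / fact (p + q + 1) * (u - l) ^ (p + q + 1)"
  have exp_sums: "(\<lambda>r. x ^ r / fact r) sums exp x" for x :: real
    using exp_converges [of x] by (simp add: divide_inverse mult.commute)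
  have f_sums: "f r w = (c ^ r / fact r) * ((w - l) ^ p * (u - w) ^ (q + r))" for r w
    by (simp add: f_def power_mult_distrib power_add)
  have poch: "pochhammer (real p + real q + 2) r = fact (p + q + 1 + r) / fact (p + q + 1)" for r
    using pochhammer_of_nat_Suc [of "p + q + 1" r, where 'a = real] by (simp add: add_ac)
  have int_f: "(f r has_integral K * T r) {l..u}" for r
  proof -
    have "K * T r = (c ^ r / fact r) *
            (fact p * fact (q + r) / fact (p + (q + r) + 1) * (u - l) ^ (p + (q + r) + 1))"
      unfolding K_def T_def poch pochhammer_of_nat_Suc
      by (simp add: power_mult_distrib power_add add_ac mult_ac del: fact_Suc)
    then show ?thesis
      using has_integral_mult_right [OF has_integral_beta [OF assms, of p "q + r"], of "c ^ r / fact r"]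
      unfolding f_sums by simp
  qed
  \<comment> \<open>On \<open>{l..u}\<close> both \<open>w - l\<close> and \<open>u - w\<close> are
    at most \<open>u - l\<close>, which gives a summable majorant; uniform convergence then permits
    integrating term by term.\<close>
  have "uniform_limit {l..u} (\<lambda>n w. \<Sum>r<n. f r w) (\<lambda>w. \<Sum>r. f r w) sequentially"
  proof (rule Weierstrass_m_test)
    fix n w assume w: "w \<in> {l..u}"
    then have "\<bar>w - l\<bar> ^ p * \<bar>u - w\<bar> ^ q * (\<bar>c * (u - w)\<bar> ^ n / fact n)
             \<le> (u - l) ^ p * (u - l) ^ q * ((\<bar>c\<bar> * (u - l)) ^ n / fact n)"
      by (intro mult_mono power_mono divide_right_mono) (auto simp: abs_mult intro!: mult_left_mono)
    then show "norm (f n w) \<le> (u - l) ^ p * (u - l) ^ q * ((\<bar>c\<bar> * (u - l)) ^ n / fact n)"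
      by (simp add: f_def abs_mult power_abs)
  next
    show "summable (\<lambda>n. (u - l) ^ p * (u - l) ^ q * ((\<bar>c\<bar> * (u - l)) ^ n / fact n))"
      using exp_sums by (intro summable_mult) (rule sums_summable)
  qed
  moreover have "(\<lambda>w. \<Sum>r. f r w) = g"
    unfolding f_def g_def using exp_sums sums_mult sums_unique by (metis (no_types, lifting) ext)
  ultimately have "uniform_limit {l..u} (\<lambda>n w. \<Sum>r<n. f r w) g sequentially"
    by simp
  moreover have "continuous_on {l..u} (\<lambda>w. \<Sum>r<n. f r w)" for n
    unfolding f_def by (intro continuous_intros) auto
  ultimately obtain I J where
    I: "\<And>n. ((\<lambda>w. \<Sum>r<n. f r w) has_integral I n) {l..u}"
    and J: "(g has_integral J) {l..u}" and lim: "I \<longlonglongrightarrow> J"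
    by (rule uniform_limit_integral) auto
  have "I = (\<lambda>n. \<Sum>r<n. K * T r)"
  proof
    fix n
    show "I n = (\<Sum>r<n. K * T r)"
      using int_f by (intro has_integral_unique [OF I] has_integral_sum) auto
  qed
  with lim have "(\<lambda>r. K * T r) sums J"
    by (simp add: sums_def)
  \<comment> \<open>\<open>K\<close> is 0 exactly when \<open>u = l\<close>, and then
    \<open>J\<close> is 0 too; otherwise summability of \<open>T\<close> follows by dividing by
    \<open>K\<close>.\<close>
  then have "J = K * (\<Sum>r. T r)"
    by (cases "K = 0") (auto simp: sums_iff suminf_mult)
  with J show ?thesis
    unfolding g_def K_def T_def Phi_def by simp
qed

text \<open>The reflection \<open>w\<close> to \<open>- w\<close> exchanges the two factors, so the
  first parameter now follows the exponent \<open>p\<close> of the factor that shares its base with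
  the exponential.\<close>

lemma has_integral_beta_exp_left:
  fixes l u c :: real
  assumes "l \<le> u"
  shows "((\<lambda>w. (w - l) ^ p * (u - w) ^ q * exp (c * (w - l))) has_integral
           fact p * fact q / fact (p + q + 1) * (u - l) ^ (p + q + 1) *
           Phi (real p + 1) (real p + real q + 2) (c * (u - l))) {l..u}"
proof -
  have "((\<lambda>w. (- w - l) ^ p * (u - - w) ^ q * exp (c * (- w - l))) has_integral
           fact p * fact q / fact (p + q + 1) * (u - l) ^ (p + q + 1) *
           Phi (real p + 1) (real p + real q + 2) (c * (u - l))) {- u..- l}"
    using has_integral_beta_exp_right [of "- u" "- l" q p c] assms
    by (simp add: add_ac mult_ac minus_diff_commute [of l])
  then show ?thesis
    by (rule has_integral_reflect_real [THEN iffD1])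
qed

section \<open>Poisson weights and their tails\<close>

lemma poi_sums: "(\<lambda>k. poi k x) sums 1"
proof -
  have "(\<lambda>k. x ^ k / fact k * exp (- x)) sums (exp x * exp (- x))"
    using exp_converges [of x] by (intro sums_mult2) (simp add: divide_inverse mult.commute)
  then show ?thesis
    by (simp add: poi_def exp_minus)
qed

lemma Poi_eq: "Poi n x = 1 - (\<Sum>k<n. poi k x)"
  using suminf_split_initial_segment [OF sums_summable [OF poi_sums [of x]], of n]
    sums_unique [OF poi_sums [of x]]
  by (simp add: Poi_def add.commute)

lemma poi_at_0: "poi n 0 = (if n = 0 then 1 else 0)"
  by (simp add: poi_def power_0_left)

lemma Poi_Suc_at_0: "Poi (Suc n) 0 = 0"
  by (simp add: Poi_eq poi_at_0 del: sum.lessThan_Suc)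

text \<open>Since \<open>poi (Suc k)\<close> has derivative \<open>poi k - poi (Suc k)\<close>, the
  sum telescopes.\<close>

lemma has_real_derivative_sum_poi:
  "((\<lambda>x. \<Sum>k<Suc n. poi k x) has_real_derivative - poi n x) (at x within S)"
proof (induction n)
  case 0
  show ?case
    by (auto simp: poi_def intro!: derivative_eq_intros)
next
  case (Suc n)
  have deriv: "((\<lambda>x. x ^ Suc n / fact (Suc n)) has_real_derivative x ^ n / fact n) (at x within S)"
    by (rule derivative_eq_intros refl)+ (simp_all del: of_nat_Suc)
  have "(poi (Suc n) has_real_derivative poi n x - poi (Suc n) x) (at x within S)"
    unfolding poi_def [abs_def] by (rule deriv derivative_eq_intros refl)+ (simp add: algebra_simps)
  from DERIV_add [OF Suc.IH this] show ?case
    by simp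
qed

lemma has_real_derivative_Poi:
  "(Poi (Suc n) has_real_derivative poi n x) (at x within S)"
  using DERIV_diff [OF DERIV_const has_real_derivative_sum_poi, of 1]
  by (simp add: Poi_eq [abs_def] del: sum.lessThan_Suc)

text \<open>For \<open>c > 0\<close> this is the Erlang distribution function: the event number
  \<open>n + 1\<close> of a Poisson process of rate \<open>c\<close> occurs by time \<open>b\<close>
  iff at least \<open>n + 1\<close> events do.\<close>

lemma has_integral_poi:
  assumes "0 \<le> b"
  shows "((\<lambda>w. c * poi n (c * w)) has_integral Poi (Suc n) (c * b)) {0..b}"
proof -
  have "((\<lambda>w. Poi (Suc n) (c * w)) has_real_derivative c * poi n (c * w)) (at w within {0..b})" for w
  proof -
    have "((\<lambda>w. c * w) has_real_derivative c) (at w within {0..b})"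
      by (auto intro!: derivative_eq_intros)
    from DERIV_chain2 [OF has_real_derivative_Poi this, of n] show ?thesis
      by (simp add: mult.commute)
  qed
  then have "((\<lambda>w. c * poi n (c * w)) has_integral Poi (Suc n) (c * b) - Poi (Suc n) (c * 0)) {0..b}"
    using assms
    by (intro fundamental_theorem_of_calculus)
       (auto simp: has_real_derivative_iff_has_vector_derivative [symmetric])
  then show ?thesis
    by (simp add: Poi_Suc_at_0)
qed

section \<open>Special values of \<open>Phi\<close>\<close>

lemma Phi_0_left: "Phi 0 \<beta> x = 1"
proof -
  have "(\<lambda>r. pochhammer 0 r / pochhammer \<beta> r * (x ^ r / fact r)) sums
          (\<Sum>r\<in>{0}. pochhammer 0 r / pochhammer \<beta> r * (x ^ r / fact r))"
    by (rule sums_finite) (auto simp: pochhammer_0_left)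
  then show ?thesis
    by (simp add: Phi_def sums_iff)
qed

text \<open>Equal parameters occur in the formula for \<open>Q_term\<close> at \<open>l = 0\<close>,
  where the Dirac delta contributes.\<close>

lemma Phi_same: "Phi (real n + 1) (real n + 1) x = exp x"
proof -
  have "pochhammer (real n + 1) r \<noteq> 0" for r
    by (simp add: pochhammer_of_nat_Suc)
  then show ?thesis
    by (simp add: Phi_def exp_def divide_inverse mult.commute)
qed

section \<open>Reduction of \<open>h_int\<close> to single densities, and the term A\<close>

lemma Poi_eq_atLeastAtMost: "Poi n x = 1 + poi n x - (\<Sum>k=0..n. poi k x)"
  by (simp add: Poi_eq atLeast0AtMost lessThan_Suc_atMost [symmetric])

lemma gam_Suc: "0 \<le> x \<Longrightarrow> gam (Suc p) x = poi p x"
  by (simp add: gam_def poi_def)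

text \<open>All four terms pass through this: only the integral against a single Gamma density
  remains to be found. The delta stays apart, to be recognised later as the summand of index 0 or to
  drop out.\<close>

lemma h_int_eq:
  assumes "\<And>k. k \<in> {1..n} \<Longrightarrow> ((\<lambda>w. a * gam k (a * w) * \<xi> w) has_integral I k) {l..u}"
  shows "h_int a n l u \<xi> =
           (if 0 \<in> {l..u} then bet a 0 n * \<xi> 0 else 0) + (\<Sum>k=1..n. bet a k n * I k)"
proof -
  have "((\<lambda>w. \<Sum>k=1..n. bet a k n * (a * gam k (a * w) * \<xi> w)) has_integral
          (\<Sum>k=1..n. bet a k n * I k)) {l..u}"
    using assms by (intro has_integral_sum has_integral_mult_right) auto
  also have "(\<lambda>w. \<Sum>k=1..n. bet a k n * (a * gam k (a * w) * \<xi> w)) =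
               (\<lambda>w. a * ((\<Sum>k=1..n. bet a k n * gam k (a * w)) * \<xi> w))"
    by (simp add: sum_distrib_left sum_distrib_right mult_ac)
  finally show ?thesis
    by (simp add: h_int_def integral_unique integral_mult_right [symmetric] del: integral_mult_right)
qed

lemma A_term_eq:
  assumes "0 < a" "0 < z"
  shows "A_term a m n y z =
           poi m (y - z) * (\<Sum>k=0..n. bet a k n * (1 + poi k (a * z) - (\<Sum>j=0..k. poi j (a * z))))"
proof -
  have "((\<lambda>w. a * gam k (a * w) * poi m (y - z)) has_integral Poi k (a * z) * poi m (y - z)) {0..z}"
    if "k \<in> {1..n}" for k
  proof -
    obtain p where k: "k = Suc p"
      using \<open>k \<in> {1..n}\<close> by (cases k) auto
    have "((\<lambda>w. a * poi p (a * w)) has_integral Poi k (a * z)) {0..z}"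
      using has_integral_poi [of z a p] assms by (simp add: k)
    then have "((\<lambda>w. a * gam k (a * w)) has_integral Poi k (a * z)) {0..z}"
      by (rule has_integral_eq [rotated]) (use assms in \<open>simp add: k gam_Suc\<close>)
    then show ?thesis
      by (rule has_integral_mult_left)
  qed
  \<comment> \<open>As \<open>Poi 0\<close> is 1, the delta contribution is the summand
    \<open>k = 0\<close> of the same form as the others.\<close>
  from h_int_eq [of n, OF this] show ?thesis
    using assms
    by (simp add: A_term_def sum.atLeast_Suc_atMost [of 0 n] Poi_eq [of 0] sum_distrib_left distrib_left
        mult_ac flip: Poi_eq_atLeastAtMost)
qed

section \<open>The term B\<close>

text \<open>The exponentials combine to \<open>exp (- z) * exp ((1 - a) * w)\<close>. The exponent
  grows with the distance from the left endpoint, so the mirrored Euler integral applies, with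
  argument \<open>(1 - a) * z\<close>.\<close>

lemma has_integral_gam_poi_B:
  assumes "0 < a" "0 < z" "0 < l"
  shows "((\<lambda>w. a * gam l (a * w) * poi k (z - w)) has_integral
           poi k z * ((a * z) ^ l * fact k / fact (k + l) * Phi (real l) (real k + real l + 1) ((1 - a) * z)))
         {0..z}"
proof -
  obtain p where l: "l = Suc p"
    using \<open>0 < l\<close> by (cases l) auto
  let ?c = "a ^ l * exp (- z) / (fact p * fact k)"
  have eq: "a * gam l (a * w) * poi k (z - w) =
          ?c * ((w - 0) ^ p * (z - w) ^ k * exp ((1 - a) * (w - 0)))" if "w \<in> {0..z}" for w
  proof -
    have "exp (- (a * w)) * exp (- (z - w)) = exp (- z) * exp ((1 - a) * w)"
      by (simp add: exp_add [symmetric] algebra_simps)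
    then show ?thesis
      using that assms by (simp add: l gam_Suc poi_def power_mult_distrib mult_ac)
  qed
  have val: "?c * (fact p * fact k / fact (p + k + 1) * (z - 0) ^ (p + k + 1) *
           Phi (real p + 1) (real p + real k + 2) ((1 - a) * (z - 0))) =
         poi k z * ((a * z) ^ l * fact k / fact (k + l) * Phi (real l) (real k + real l + 1) ((1 - a) * z))"
    by (simp add: l poi_def power_mult_distrib power_add add_ac mult_ac del: fact_Suc)
  show ?thesis
    using has_integral_mult_right [OF has_integral_beta_exp_left [of 0 z p k "1 - a"], of ?c] assms
    unfolding val by (subst has_integral_cong [OF eq]) simp_all
qed

lemma B_term_eq:
  assumes "0 < a" "0 < z"
  shows "B_term a m n y z =
        poi m (y - z) *
          (\<Sum>k=0..n - m. poi k z *
            (\<Sum>l=0..n + 1. bet a l (n + 1) * ((a * z) ^ l * fact k / fact (k + l)) *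
               Phi (real l) (real k + real l + 1) ((1 - a) * z)))"
proof -
  define J where "J l k = (a * z) ^ l * fact k / fact (k + l) *
    Phi (real l) (real k + real l + 1) ((1 - a) * z)" for l k
  have "((\<lambda>w. a * gam l (a * w) * ((\<Sum>k=0..n - m. poi k (z - w)) * poi m (y - z))) has_integral
          (\<Sum>k=0..n - m. poi k z * J l k) * poi m (y - z)) {0..z}" if "l \<in> {1..n + 1}" for l
  proof -
    have "((\<lambda>w. (\<Sum>k=0..n - m. a * gam l (a * w) * poi k (z - w)) * poi m (y - z)) has_integral
          (\<Sum>k=0..n - m. poi k z * J l k) * poi m (y - z)) {0..z}"
      unfolding J_def using that assms
      by (intro has_integral_mult_left has_integral_sum has_integral_gam_poi_B) auto
    then show ?thesis
      by (simp add: sum_distrib_left mult_ac)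
  qed
  from h_int_eq [OF this]
  have "B_term a m n y z = bet a 0 (n + 1) * ((\<Sum>k=0..n - m. poi k z) * poi m (y - z)) +
          (\<Sum>l=1..n + 1. bet a l (n + 1) * ((\<Sum>k=0..n - m. poi k z * J l k) * poi m (y - z)))"
    using assms by (simp add: B_term_def)
  \<comment> \<open>\<open>J 0 k\<close> is 1, since \<open>Phi\<close> with first parameter 0 is 1;
    so the delta contribution is the summand \<open>l = 0\<close>.\<close>
  also have "\<dots> = (\<Sum>l=0..n + 1. bet a l (n + 1) * ((\<Sum>k=0..n - m. poi k z * J l k) * poi m (y - z)))"
    by (subst (2) sum.atLeast_Suc_atMost) (simp_all add: J_def Phi_0_left)
  also have "\<dots> = (\<Sum>l=0..n + 1. \<Sum>k=0..n - m. poi m (y - z) * (poi k z * (bet a l (n + 1) * J l k)))"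
    by (simp add: sum_distrib_left sum_distrib_right mult_ac)
  also have "\<dots> = poi m (y - z) * (\<Sum>k=0..n - m. poi k z * (\<Sum>l=0..n + 1. bet a l (n + 1) * J l k))"
    by (subst sum.swap) (simp only: sum_distrib_left)
  finally show ?thesis
    by (simp add: J_def mult.assoc)
qed

section \<open>The term Q\<close>

text \<open>In Q the integration starts at 0, so \<open>w - z\<close> is not the distance to an
  endpoint and has to be eliminated. The two exponentials multiply to the constant
  \<open>exp (- (y - z))\<close>, which leaves pure powers of \<open>y - w\<close>.\<close>

lemma poi_mult_poi_expand:
  assumes "k \<le> m"
  shows "poi (m - k) (w - z) * poi k (y - w) =
    (\<Sum>j=k..m. (-1) ^ (j - k) * real (j choose k) * poi (m - j) (y - z) * ((y - w) ^ j / fact j))"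
proof -
  have "(w - z) ^ (m - k) = (- (y - w) + (y - z)) ^ (m - k)"
    by simp
  also have "\<dots> = (\<Sum>i\<le>m - k. real (m - k choose i) * (- (y - w)) ^ i * (y - z) ^ (m - k - i))"
    by (rule binomial_ring)
  \<comment> \<open>The new index \<open>j = i + k\<close> is the total power of
    \<open>y - w\<close> once the factor from \<open>poi k (y - w)\<close> is included.\<close>
  also have "\<dots> = (\<Sum>j=k..m. real (m - k choose (j - k)) * (- (y - w)) ^ (j - k) * (y - z) ^ (m - j))"
    using assms
    by (intro sum.reindex_bij_witness [of _ "\<lambda>j. j - k" "\<lambda>i. i + k"])
       (auto simp: add.commute)
  finally have pow: "(w - z) ^ (m - k) =
    (\<Sum>j=k..m. real (m - k choose (j - k)) * (- (y - w)) ^ (j - k) * (y - z) ^ (m - j))" .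
  have expon: "exp (- (w - z)) * exp (- (y - w)) = exp (- (y - z))"
    by (simp add: exp_add [symmetric])
  have "poi (m - k) (w - z) * poi k (y - w) =
      (w - z) ^ (m - k) * ((y - w) ^ k * exp (- (y - z)) / (fact (m - k) * fact k))"
    by (simp add: poi_def mult_ac del: minus_diff_eq flip: expon)
  also have "\<dots> = (\<Sum>j=k..m. (-1) ^ (j - k) * real (j choose k) * poi (m - j) (y - z) * ((y - w) ^ j / fact j))"
    unfolding pow sum_distrib_right
  proof (rule sum.cong [OF refl])
    fix j assume "j \<in> {k..m}"
    then obtain i where j: "j = k + i" and i: "i \<le> m - k"
      by (metis atLeastAtMost_iff le_Suc_ex add_le_imp_le_diff add.commute)
    have "real (m - k choose i) = fact (m - k) / (fact i * fact (m - k - i))"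
      using i by (rule binomial_fact)
    moreover have "real (k + i choose k) = fact (k + i) / (fact k * fact i)"
      using binomial_fact [of k "k + i", where 'a = real] by simp
    ultimately show "real (m - k choose (j - k)) * (- (y - w)) ^ (j - k) * (y - z) ^ (m - j) *
        ((y - w) ^ k * exp (- (y - z)) / (fact (m - k) * fact k)) =
      (-1) ^ (j - k) * real (j choose k) * poi (m - j) (y - z) * ((y - w) ^ j / fact j)"
      by (simp add: j poi_def power_minus [of "y - w"] power_add mult_ac del: minus_diff_eq)
  qed
  finally show ?thesis .
qed

text \<open>Writing \<open>exp (- (a * w))\<close> as
  \<open>exp (- (a * y)) * exp (a * (y - w))\<close> gives Euler's integral. The density supplies
  \<open>a ^ l\<close> but \<open>poi (j + l) (a * y)\<close> carries \<open>a ^ (j + l)\<close>,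
  whence the division by \<open>a ^ j\<close>.\<close>

lemma has_integral_gam_power_Q:
  assumes "0 < a" "0 < y" "0 < l"
  shows "((\<lambda>w. a * gam l (a * w) * ((y - w) ^ j / fact j)) has_integral
           poi (j + l) (a * y) * Phi (real j + 1) (real j + real l + 1) (a * y) / a ^ j) {0..y}"
proof -
  obtain p where l: "l = Suc p"
    using \<open>0 < l\<close> by (cases l) auto
  let ?c = "a ^ l * exp (- (a * y)) / (fact p * fact j)"
  have eq: "a * gam l (a * w) * ((y - w) ^ j / fact j) =
          ?c * ((w - 0) ^ p * (y - w) ^ j * exp (a * (y - w)))" if "w \<in> {0..y}" for w
  proof -
    have "exp (- (a * w)) = exp (- (a * y)) * exp (a * (y - w))"
      by (simp add: exp_add [symmetric] algebra_simps)
    then show ?thesis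
      using that assms by (simp add: l gam_Suc poi_def power_mult_distrib mult_ac)
  qed
  have val: "?c * (fact p * fact j / fact (p + j + 1) * (y - 0) ^ (p + j + 1) *
           Phi (real j + 1) (real p + real j + 2) (a * (y - 0))) =
         poi (j + l) (a * y) * Phi (real j + 1) (real j + real l + 1) (a * y) / a ^ j"
    using assms by (simp add: l poi_def power_mult_distrib power_add add_ac mult_ac del: fact_Suc)
  show ?thesis
    using has_integral_mult_right [OF has_integral_beta_exp_right [of 0 y p j a], of ?c] assms
    unfolding val by (subst has_integral_cong [OF eq]) simp_all
qed

lemma Q_term_eq:
  assumes "0 < a" "0 < y" "n \<le> m"
  shows "Q_term a m n y z =
        (\<Sum>k=n..m. \<Sum>j=k..m. (-1) ^ (j - k) / a ^ j * real (j choose k) *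
          (\<Sum>l=0..n. bet a l n * poi (m - j) (y - z) * poi (j + l) (a * y) *
             Phi (real j + 1) (real j + real l + 1) (a * y)))"
proof -
  define G where "G k j = (-1) ^ (j - k) * real (j choose k) * poi (m - j) (y - z)" for k j
  define J where "J l j = poi (j + l) (a * y) * Phi (real j + 1) (real j + real l + 1) (a * y) / a ^ j"
    for l j
  have expand: "(\<Sum>k=n..m. poi (m - k) (w - z) * poi k (y - w)) =
      (\<Sum>k=n..m. \<Sum>j=k..m. G k j * ((y - w) ^ j / fact j))" for w
    unfolding G_def by (intro sum.cong refl poi_mult_poi_expand) auto
  \<comment> \<open>The value \<open>exp (a * y)\<close> of \<open>Phi\<close> at equal parameters
    cancels the exponential in \<open>poi j (a * y)\<close>. Thus the delta, which evaluates at
    \<open>w = 0\<close>, yields the summand \<open>l = 0\<close>.\<close>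
  have J0: "(y - 0) ^ j / fact j = J 0 j" for j
    using assms Phi_same [of j "a * y"]
    by (simp add: J_def poi_def exp_minus field_simps)
  have "((\<lambda>w. a * gam l (a * w) * (\<Sum>k=n..m. poi (m - k) (w - z) * poi k (y - w))) has_integral
          (\<Sum>k=n..m. \<Sum>j=k..m. G k j * J l j)) {0..y}" if "l \<in> {1..n}" for l
  proof -
    have "((\<lambda>w. \<Sum>k=n..m. \<Sum>j=k..m. G k j * (a * gam l (a * w) * ((y - w) ^ j / fact j)))
            has_integral (\<Sum>k=n..m. \<Sum>j=k..m. G k j * J l j)) {0..y}"
      unfolding J_def using that assms
      by (intro has_integral_sum has_integral_mult_right has_integral_gam_power_Q) auto
    then show ?thesis
      unfolding expand by (simp add: sum_distrib_left mult_ac)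
  qed
  from h_int_eq [OF this]
  have "Q_term a m n y z = bet a 0 n * (\<Sum>k=n..m. \<Sum>j=k..m. G k j * J 0 j) +
          (\<Sum>l=1..n. bet a l n * (\<Sum>k=n..m. \<Sum>j=k..m. G k j * J l j))"
    using assms unfolding Q_term_def expand J0 by simp
  also have "\<dots> = (\<Sum>l=0..n. bet a l n * (\<Sum>k=n..m. \<Sum>j=k..m. G k j * J l j))"
    by (subst (2) sum.atLeast_Suc_atMost) simp_all
  also have "\<dots> = (\<Sum>l=0..n. \<Sum>k=n..m. \<Sum>j=k..m. bet a l n * (G k j * J l j))"
    by (simp add: sum_distrib_left)
  also have "\<dots> = (\<Sum>k=n..m. \<Sum>l=0..n. \<Sum>j=k..m. bet a l n * (G k j * J l j))"
    by (rule sum.swap)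
  also have "\<dots> = (\<Sum>k=n..m. \<Sum>j=k..m. \<Sum>l=0..n. bet a l n * (G k j * J l j))"
    by (intro sum.cong refl sum.swap)
  finally show ?thesis
    by (simp add: G_def J_def sum_distrib_left mult_ac)
qed

section \<open>The term C\<close>

text \<open>On \<open>{z..y}\<close> both Poisson weights already carry powers of distances to the
  endpoints; only the power \<open>w ^ (l - 1)\<close> of the density needs expanding. Expanding it
  about \<open>y\<close> matches the factor \<open>exp (a * (y - w))\<close>.\<close>

lemma has_integral_gam_poi_C:
  assumes "0 < a" "0 < z" "z < y" "0 < l" "k \<le> m"
  shows "((\<lambda>w. a * gam l (a * w) * (poi (m - k) (w - z) * poi k (y - w))) has_integral
           exp (- ((1 - a) * (y - z))) / a ^ m *
           (\<Sum>j=0..l - 1. (-1) ^ (l - 1 - j) * real ((k + l - j - 1) choose k) *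
               poi j (a * y) * poi (m + l - j) (a * (y - z)) *
               Phi (real k + real l - real j) (real m + real l - real j + 1) (a * (y - z)))) {z..y}"
proof -
  obtain p where l: "l = Suc p"
    using \<open>0 < l\<close> by (cases l) auto
  obtain q where m: "m = k + q"
    using \<open>k \<le> m\<close> le_Suc_ex by blast
  \<comment> \<open>\<open>c j\<close> collects everything independent of \<open>w\<close>:
    normalisations, constant exponentials and the binomial coefficient of
    \<open>y ^ j\<close>.\<close>
  define c where "c j = a ^ l * exp (- (y - z)) * exp (- (a * y)) / (fact p * fact q * fact k) *
      (real (p choose j) * y ^ j * (-1) ^ (p - j))" for j
  have "a * gam l (a * w) * (poi (m - k) (w - z) * poi k (y - w)) =
          (\<Sum>j=0..p. c j * ((w - z) ^ q * (y - w) ^ (k + (p - j)) * exp (a * (y - w))))"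
    if "w \<in> {z..y}" for w
  proof -
    have "w ^ p = (y + - (y - w)) ^ p"
      by simp
    also have "\<dots> = (\<Sum>j\<le>p. real (p choose j) * y ^ j * (- (y - w)) ^ (p - j))"
      by (rule binomial_ring)
    finally have pow: "w ^ p = (\<Sum>j=0..p. real (p choose j) * y ^ j * (- (y - w)) ^ (p - j))"
      by (simp add: atLeast0AtMost)
    have "exp (- (a * w)) * exp (- (w - z)) * exp (- (y - w)) =
            exp (- (y - z)) * exp (- (a * y)) * exp (a * (y - w))"
      by (simp add: exp_add [symmetric] algebra_simps)
    then have "a * gam l (a * w) * (poi (m - k) (w - z) * poi k (y - w)) =
       w ^ p * (a ^ l * exp (- (y - z)) * exp (- (a * y)) / (fact p * fact q * fact k) *
         ((w - z) ^ q * (y - w) ^ k * exp (a * (y - w))))"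
      using that assms by (simp add: l m gam_Suc poi_def power_mult_distrib mult_ac)
    then show ?thesis
      unfolding pow sum_distrib_right
      by (simp only: c_def power_minus [of "y - w"] power_add mult_ac)
  qed
  moreover have "((\<lambda>w. \<Sum>j=0..p. c j * ((w - z) ^ q * (y - w) ^ (k + (p - j)) * exp (a * (y - w))))
      has_integral (\<Sum>j=0..p. c j * (fact q * fact (k + (p - j)) / fact (q + (k + (p - j)) + 1) *
        (y - z) ^ (q + (k + (p - j)) + 1) *
        Phi (real (k + (p - j)) + 1) (real q + real (k + (p - j)) + 2) (a * (y - z))))) {z..y}"
    using assms by (intro has_integral_sum has_integral_mult_right has_integral_beta_exp_right) auto
  moreover have "(\<Sum>j=0..p. c j * (fact q * fact (k + (p - j)) / fact (q + (k + (p - j)) + 1) *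
        (y - z) ^ (q + (k + (p - j)) + 1) *
        Phi (real (k + (p - j)) + 1) (real q + real (k + (p - j)) + 2) (a * (y - z)))) =
      exp (- ((1 - a) * (y - z))) / a ^ m *
           (\<Sum>j=0..l - 1. (-1) ^ (l - 1 - j) * real ((k + l - j - 1) choose k) *
               poi j (a * y) * poi (m + l - j) (a * (y - z)) *
               Phi (real k + real l - real j) (real m + real l - real j + 1) (a * (y - z)))"
    unfolding sum_distrib_left
  proof (rule sum.cong)
    show "{0..p} = {0..l - 1}"
      by (simp add: l)
  next
    fix j assume "j \<in> {0..l - 1}"
    then obtain i where p: "p = j + i"
      by (auto simp: l le_iff_add)
    have "real (p choose j) = fact p / (fact j * fact i)"
      using binomial_fact [of j p, where 'a = real] by (simp add: p)
    moreover have "real (k + l - j - 1 choose k) = fact (k + i) / (fact k * fact i)"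
      using binomial_fact [of k "k + i", where 'a = real] by (simp add: l p)
    \<comment> \<open>The second factor goes into \<open>poi (m + l - j) (a * (y - z))\<close>, the
      first is the common prefactor.\<close>
    moreover have "exp (- (y - z)) = exp (- ((1 - a) * (y - z))) * exp (- (a * (y - z)))"
      by (simp add: exp_add [symmetric] algebra_simps)
    moreover have "m + l - j = q + (k + i) + 1" "l - 1 - j = i" "p - j = i"
      by (simp_all add: l m p)
    moreover have "real k + real l - real j = real (k + i) + 1"
      "real m + real l - real j + 1 = real q + real (k + i) + 2"
      by (simp_all add: l m p)
    \<comment> \<open>The two Poisson weights of the result carry \<open>a ^ (m + l)\<close> in
      total, whence the division by \<open>a ^ m\<close>.\<close>
    moreover have "a ^ l = a ^ j * a ^ (q + (k + i) + 1) / a ^ m"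
      using assms by (simp add: l m p power_add)
    ultimately show "c j * (fact q * fact (k + (p - j)) / fact (q + (k + (p - j)) + 1) *
        (y - z) ^ (q + (k + (p - j)) + 1) *
        Phi (real (k + (p - j)) + 1) (real q + real (k + (p - j)) + 2) (a * (y - z))) =
      exp (- ((1 - a) * (y - z))) / a ^ m *
           ((-1) ^ (l - 1 - j) * real ((k + l - j - 1) choose k) *
               poi j (a * y) * poi (m + l - j) (a * (y - z)) *
               Phi (real k + real l - real j) (real m + real l - real j + 1) (a * (y - z)))"
      by (simp only: c_def poi_def power_mult_distrib) (simp add: mult_ac del: fact_Suc)
  qed
  ultimately show ?thesis
    by (subst has_integral_cong) auto
qed

lemma C_term_eq:
  assumes "0 < a" "0 < z" "z < y" "1 \<le> n" "n \<le> m"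
  shows "C_term a m n y z =
        exp (- ((1 - a) * (y - z))) / a ^ m *
          (\<Sum>l=1..n. bet a l n *
            (\<Sum>k=n..m. \<Sum>j=0..l - 1.
               (-1) ^ (l - 1 - j) * real ((k + l - j - 1) choose k) *
               poi j (a * y) * poi (m + l - j) (a * (y - z)) *
               Phi (real k + real l - real j) (real m + real l - real j + 1) (a * (y - z))))"
proof -
  define E where "E = exp (- ((1 - a) * (y - z))) / a ^ m"
  define J where "J l k = (\<Sum>j=0..l - 1.
               (-1) ^ (l - 1 - j) * real ((k + l - j - 1) choose k) *
               poi j (a * y) * poi (m + l - j) (a * (y - z)) *
               Phi (real k + real l - real j) (real m + real l - real j + 1) (a * (y - z)))" for l k
  have "((\<lambda>w. a * gam l (a * w) * (\<Sum>k=n..m. poi (m - k) (w - z) * poi k (y - w))) has_integral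
          (\<Sum>k=n..m. E * J l k)) {z..y}" if "l \<in> {1..n}" for l
  proof -
    have "((\<lambda>w. \<Sum>k=n..m. a * gam l (a * w) * (poi (m - k) (w - z) * poi k (y - w))) has_integral
            (\<Sum>k=n..m. E * J l k)) {z..y}"
      unfolding E_def J_def using that assms
      by (intro has_integral_sum has_integral_gam_poi_C) auto
    then show ?thesis
      by (simp add: sum_distrib_left)
  qed
  \<comment> \<open>As \<open>0 < z\<close>, the point 0 lies outside \<open>{z..y}\<close>: the
    delta contributes nothing and the sum starts at \<open>l = 1\<close>.\<close>
  from h_int_eq [OF this]
  have "C_term a m n y z = (\<Sum>l=1..n. bet a l n * (\<Sum>k=n..m. E * J l k))"
    using assms by (simp add: C_term_def)
  then show ?thesis
    by (simp add: E_def J_def sum_distrib_left mult_ac)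
qed

section \<open>Closed form of \<open>Phi\<close> for integer parameters\<close>

lemma Phi_closed_form:
  assumes "x \<noteq> 0"
  shows "Phi (real q + 1) (real p + real q + 2) x =
    exp x * (\<Sum>i=0..q. (-1) ^ (q - i) * real ((p + q - i) choose p) *
      (poi i x / poi (p + q + 1) x) * Poi (p + q + 1 - i) x)"
proof -
  \<comment> \<open>This is the Erlang integral up to \<open>b = 1\<close>, rescaled by powers of
    \<open>x\<close>; here \<open>x\<close> must be nonzero.\<close>
  have pow_int: "((\<lambda>w. w ^ n * exp (- (x * w))) has_integral fact n / x ^ Suc n * Poi (Suc n) x) {0..1}" for n
  proof -
    have "(\<lambda>w. fact n / x ^ Suc n * (x * poi n (x * w))) = (\<lambda>w. w ^ n * exp (- (x * w)))"
      using assms by (simp add: poi_def power_mult_distrib)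
    then show ?thesis
      using has_integral_mult_right [OF has_integral_poi [of 1 x n], of "fact n / x ^ Suc n"] by simp
  qed
  have "(w - 0) ^ p * (1 - w) ^ q * exp (x * (1 - w)) =
      (\<Sum>i=0..q. exp x * real (q choose i) * (-1) ^ (q - i) * (w ^ (p + q - i) * exp (- (x * w))))" for w
  proof -
    have "(1 - w) ^ q = (\<Sum>i\<le>q. real (q choose i) * 1 ^ i * (- w) ^ (q - i))"
      using binomial_ring [of 1 "- w" q] by simp
    then have "w ^ p * (1 - w) ^ q = (\<Sum>i=0..q. w ^ p * (real (q choose i) * 1 ^ i * (- w) ^ (q - i)))"
      by (simp only: sum_distrib_left atLeast0AtMost)
    also have "\<dots> = (\<Sum>i=0..q. real (q choose i) * (-1) ^ (q - i) * w ^ (p + q - i))"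
      by (intro sum.cong refl) (simp add: power_minus [of w] flip: power_add)
    finally have "w ^ p * (1 - w) ^ q = (\<Sum>i=0..q. real (q choose i) * (-1) ^ (q - i) * w ^ (p + q - i))" .
    moreover have "exp (x * (1 - w)) = exp x * exp (- (x * w))"
      by (simp add: exp_add [symmetric] algebra_simps)
    ultimately show ?thesis
      by (simp add: sum_distrib_left sum_distrib_right mult_ac)
  qed
  moreover have "((\<lambda>w. \<Sum>i=0..q. exp x * real (q choose i) * (-1) ^ (q - i) * (w ^ (p + q - i) * exp (- (x * w))))
    has_integral (\<Sum>i=0..q. exp x * real (q choose i) * (-1) ^ (q - i) *
      (fact (p + q - i) / x ^ Suc (p + q - i) * Poi (Suc (p + q - i)) x))) {0..1}"
    by (intro has_integral_sum has_integral_mult_right pow_int) auto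
  \<comment> \<open>The same integral over \<open>{0..1}\<close> is evaluated by Euler's formula and
    by the expansion.\<close>
  ultimately have "fact p * fact q / fact (p + q + 1) * Phi (real q + 1) (real p + real q + 2) x =
    (\<Sum>i=0..q. exp x * real (q choose i) * (-1) ^ (q - i) *
      (fact (p + q - i) / x ^ Suc (p + q - i) * Poi (Suc (p + q - i)) x))"
    using has_integral_beta_exp_right [of 0 1 p q x] by (auto dest: has_integral_unique)
  then have "Phi (real q + 1) (real p + real q + 2) x = fact (p + q + 1) / (fact p * fact q) *
    (\<Sum>i=0..q. exp x * real (q choose i) * (-1) ^ (q - i) *
      (fact (p + q - i) / x ^ Suc (p + q - i) * Poi (Suc (p + q - i)) x))"
    by (simp add: field_simps del: fact_Suc)
  also have "\<dots> = exp x * (\<Sum>i=0..q. (-1) ^ (q - i) * real ((p + q - i) choose p) *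
      (poi i x / poi (p + q + 1) x) * Poi (p + q + 1 - i) x)"
    unfolding sum_distrib_left
  proof (rule sum.cong [OF refl])
    fix i assume "i \<in> {0..q}"
    then obtain r where q: "q = i + r"
      by (auto simp: le_iff_add)
    have "real (q choose i) = fact q / (fact i * fact r)"
      using binomial_fact [of i q, where 'a = real] by (simp add: q)
    moreover have "real (p + q - i choose p) = fact (p + r) / (fact p * fact r)"
      using binomial_fact [of p "p + r", where 'a = real] by (simp add: q)
    moreover have "poi i x / poi (p + q + 1) x = fact (p + q + 1) / fact i / x ^ Suc (p + r)"
      using assms by (simp add: poi_def q power_add field_simps del: fact_Suc)
    moreover have "p + q - i = p + r" "p + q + 1 - i = Suc (p + r)" "q - i = r"
      by (simp_all add: q)
    ultimately show "fact (p + q + 1) / (fact p * fact q) * (exp x * real (q choose i) * (-1) ^ (q - i) *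
      (fact (p + q - i) / x ^ Suc (p + q - i) * Poi (Suc (p + q - i)) x)) =
      exp x * ((-1) ^ (q - i) * real ((p + q - i) choose p) *
      (poi i x / poi (p + q + 1) x) * Poi (p + q + 1 - i) x)"
      by (simp only:) (simp add: mult_ac del: fact_Suc)
  qed
  finally show ?thesis .
qed

text \<open>The substitution is \<alpha> = q + 1, \<beta> = p + q + 2, \<gamma> = i + 1. The
  integrated power of \<open>w\<close> is then \<beta> - \<gamma> - 1, and the tail index is one
  more.\<close>

lemma Phi_closed_form_nat:
  fixes \<alpha> \<beta> :: nat
  assumes "1 \<le> \<alpha>" "\<alpha> < \<beta>" "x \<noteq> 0"
  shows "Phi (real \<alpha>) (real \<beta>) x =
        exp x * (\<Sum>\<gamma>=1..\<alpha>. (-1) ^ (\<alpha> - \<gamma>) * real ((\<beta> - \<gamma> - 1) choose (\<beta> - \<alpha> - 1)) *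
          (poi (\<gamma> - 1) x / poi (\<beta> - 1) x) * Poi (\<beta> - \<gamma>) x)"
proof -
  obtain q where q: "\<alpha> = Suc q"
    using assms by (cases \<alpha>) auto
  obtain p where p: "\<beta> = p + q + 2"
    using assms by (auto simp: q less_iff_Suc_add)
  have "(\<Sum>\<gamma>=1..\<alpha>. (-1) ^ (\<alpha> - \<gamma>) * real ((\<beta> - \<gamma> - 1) choose (\<beta> - \<alpha> - 1)) *
          (poi (\<gamma> - 1) x / poi (\<beta> - 1) x) * Poi (\<beta> - \<gamma>) x) =
        (\<Sum>i=0..q. (-1) ^ (q - i) * real ((p + q - i) choose p) *
          (poi i x / poi (p + q + 1) x) * Poi (p + q + 1 - i) x)"
    by (simp add: p q sum.shift_bounds_cl_Suc_ivl del: sum.cl_ivl_Suc)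
  then show ?thesis
    using Phi_closed_form [OF \<open>x \<noteq> 0\<close>, of q p] by (simp add: p q add_ac)
qed

(* Conjuncts: signs of y and z; (i) Q; (ii) A, B, C, C for n = 0; (iii) the parameters of Phi in the
   formulas for Q (without the terms l = 0, where they are equal), B and C; then the values
   of Phi and the closed form of Poi.  In the closed form of Phi the factor is Poi (\<beta> - \<gamma>);
   with Poi (\<alpha> - \<gamma> + 1) it would be false, for example for \<alpha> = 1, \<beta> = 3. *)
theorem proposition5p4:
  fixes lam mu a s t y z :: real
  assumes "lam > 0" and "mu > 0" and "0 < a" and "a < 1" and "s > 0" and "t > 0"
    and "y = lam * t / a" and "z = (lam * t - a * mu * s) / a"
  shows "(y > 0 \<and> z < y \<and> (z < 0 \<longleftrightarrow> a * mu * s > lam * t) \<and> (z > 0 \<longleftrightarrow> a * mu * s < lam * t)) \<and>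
     (z < 0 \<longrightarrow> (\<forall>m n. n \<le> m \<longrightarrow>
      Q_term a m n y z =
        (\<Sum>k=n..m. \<Sum>j=k..m. (-1) ^ (j - k) / a ^ j * real (j choose k) *
          (\<Sum>l=0..n. bet a l n * poi (m - j) (y - z) * poi (j + l) (a * y) *
             Phi (real j + 1) (real j + real l + 1) (a * y))))) \<and>
     (z > 0 \<longrightarrow> (\<forall>m n.
      A_term a m n y z =
        poi m (y - z) *
          (\<Sum>k=0..n. bet a k n * (1 + poi k (a * z) - (\<Sum>j=0..k. poi j (a * z)))))) \<and>
     (z > 0 \<longrightarrow> (\<forall>m n. m \<le> n \<longrightarrow>
      B_term a m n y z =
        poi m (y - z) *
          (\<Sum>k=0..n - m. poi k z *
            (\<Sum>l=0..n + 1. bet a l (n + 1) * ((a * z) ^ l * fact k / fact (k + l)) *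
               Phi (real l) (real k + real l + 1) ((1 - a) * z))))) \<and>
     (z > 0 \<longrightarrow> (\<forall>m n. 1 \<le> n \<and> n \<le> m \<longrightarrow>
      C_term a m n y z =
        exp (- ((1 - a) * (y - z))) / a ^ m *
          (\<Sum>l=1..n. bet a l n *
            (\<Sum>k=n..m. \<Sum>j=0..l - 1.
               (-1) ^ (l - 1 - j) * real ((k + l - j - 1) choose k) *
               poi j (a * y) * poi (m + l - j) (a * (y - z)) *
               Phi (real k + real l - real j) (real m + real l - real j + 1) (a * (y - z)))))) \<and>
     (z > 0 \<longrightarrow> (\<forall>m. C_term a m 0 y z = 0)) \<and>
     (\<forall>m n k j l. n \<le> k \<and> k \<le> j \<and> j \<le> m \<and> 1 \<le> l \<and> l \<le> n \<longrightarrow>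
      admissible (real j + 1) (real j + real l + 1)) \<and>
     (\<forall>m n k l. m \<le> n \<and> k \<le> n - m \<and> l \<le> n + 1 \<longrightarrow>
      admissible (real l) (real k + real l + 1)) \<and>
     (\<forall>m n k j l. 1 \<le> l \<and> l \<le> n \<and> n \<le> k \<and> k \<le> m \<and> j \<le> l - 1 \<longrightarrow>
      admissible (real k + real l - real j) (real m + real l - real j + 1)) \<and>
     (\<forall>\<beta>::nat. \<forall>x. 0 < \<beta> \<longrightarrow> Phi 0 (real \<beta>) x = 1) \<and>
     (\<forall>(\<alpha>::nat) (\<beta>::nat) x. 1 \<le> \<alpha> \<and> \<alpha> < \<beta> \<and> x \<noteq> 0 \<longrightarrow>
      Phi (real \<alpha>) (real \<beta>) x =
        exp x * (\<Sum>\<gamma>=1..\<alpha>. (-1) ^ (\<alpha> - \<gamma>) * real ((\<beta> - \<gamma> - 1) choose (\<beta> - \<alpha> - 1)) *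
          (poi (\<gamma> - 1) x / poi (\<beta> - 1) x) * Poi (\<beta> - \<gamma>) x)) \<and>
     (\<forall>(\<alpha>::nat) x. 1 \<le> \<alpha> \<longrightarrow> Phi (real \<alpha>) (real \<alpha>) x = exp x) \<and>
     (\<forall>n x. Poi n x = 1 - (\<Sum>k<n. poi k x))"
proof -
  have y: "0 < y"
    using assms by simp
  have "z < y"
    using assms by (simp add: divide_strict_right_mono)
  have signs: "z < 0 \<longleftrightarrow> a * mu * s > lam * t" "z > 0 \<longleftrightarrow> a * mu * s < lam * t"
    using \<open>0 < a\<close> by (simp_all add: assms(8) divide_less_0_iff zero_less_divide_iff)
  have C0: "C_term a m 0 y z = 0" for m
    by (simp add: C_term_def)
  have adm_Q: "admissible (real j + 1) (real j + real l + 1)" if "1 \<le> l" for j l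
    using that by (simp add: admissible_def)
  have adm_B: "admissible (real l) (real k + real l + 1)" for k l
    by (simp add: admissible_def)
  have adm_C: "admissible (real k + real l - real j) (real m + real l - real j + 1)"
    if "1 \<le> l" "k \<le> m" "j \<le> l - 1" for m k j l
  proof -
    \<comment> \<open>The parameters are differences of reals: \<open>j \<le> l\<close> makes the
      first one nonnegative, and \<open>k \<le> m\<close> makes it smaller than the second.\<close>
    have "real j \<le> real l"
      using that by simp
    then show ?thesis
      using that by (auto simp: admissible_def)
  qed
  have Phi_exp: "Phi (real \<alpha>) (real \<alpha>) x = exp x" if "1 \<le> \<alpha>" for \<alpha> :: nat and x
    using that Phi_same [of "\<alpha> - 1" x] by (simp add: of_nat_diff)
  show ?thesis
    apply (intro conjI impI allI)
    subgoal by (rule y)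
    subgoal by (rule \<open>z < y\<close>)
    subgoal by (rule signs)
    subgoal by (rule signs)
    subgoal by (rule Q_term_eq [OF \<open>0 < a\<close> y])
    subgoal by (rule A_term_eq [OF \<open>0 < a\<close>])
    subgoal by (rule B_term_eq [OF \<open>0 < a\<close>])
    subgoal using \<open>0 < a\<close> \<open>z < y\<close> by (intro C_term_eq) auto
    subgoal by (rule C0)
    subgoal by (rule adm_Q) simp
    subgoal by (rule adm_B)
    subgoal by (rule adm_C) simp_all
    subgoal by (rule Phi_0_left)
    subgoal by (rule Phi_closed_form_nat) simp_all
    subgoal by (rule Phi_exp)
    subgoal by (rule Poi_eq)
    done
qed

end
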